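(* For all integers $a,b\geq 1$, the infinite word $\mathfrak{F}^{(a,b)}$ has palindromic prefixes of arbitrarily large length; in particular $P_{\mathfrak{F}^{(a,b)}}\bigl(|\mathfrak{F}^{(a,b)}_n|-2\bigr)\geq 1$ for every $n\geq 2$.
   Context: Words are over the alphabet $\{0,1\}$; $|w|$ is the length of $w$. For integers $a,b\geq 1$ let $\mathfrak{F}^{(a,b)}_0=1$, $\mathfrak{F}^{(a,b)}_1=0$, and for $n\geq 2$: $\mathfrak{F}^{(a,b)}_n=(\mathfrak{F}^{(a,b)}_{n-1})^a\,\mathfrak{F}^{(a,b)}_{n-2}$ if $n$ is even, $\mathfrak{F}^{(a,b)}_n=(\mathfrak{F}^{(a,b)}_{n-1})^b\,\mathfrak{F}^{(a,b)}_{n-2}$ if $n$ is odd. The infinite word $\mathfrak{F}^{(a,b)}=\lim_{n\to\infty}\mathfrak{F}^{(a,b)}_n$ is the unique infinite word having every $\mathfrak{F}^{(a,b)}_n$, $n\geq 1$, as a prefix. A finite word is a palindrome if it equals its reversal. The palindromic complexity $P_w(n)$ of an infinite word $w$ is the number of distinct palindromic factors of $w$ of length $n$. *)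

theory Defs
  imports Complex_Main "HOL-Library.Omega_Words_Fun"
begin

datatype letter = Zero | One

fun fib_word :: "nat \<Rightarrow> nat \<Rightarrow> nat \<Rightarrow> letter list" where
  "fib_word a b 0 = [One]"
| "fib_word a b (Suc 0) = [Zero]"
| "fib_word a b (Suc (Suc n)) =
     concat (replicate (if even (Suc (Suc n)) then a else b) (fib_word a b (Suc n)))
       @ fib_word a b n"

text \<open>The index 0 is excluded because the word of index 0 is not a prefix of the limit.
  For positive parameters the description below is satisfied by exactly one infinite word,
  see \<open>ex1_inf_fib_word\<close>.\<close>

definition inf_fib_word :: "nat \<Rightarrow> nat \<Rightarrow> letter word" where
  "inf_fib_word a b =
     (THE w. \<forall>n\<ge>1. prefix (length (fib_word a b n)) w = fib_word a b n)"

definition palindrome :: "'a list \<Rightarrow> bool" where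
  "palindrome u \<longleftrightarrow> rev u = u"

definition factor :: "'a list \<Rightarrow> 'a word \<Rightarrow> bool" where
  "factor u w \<longleftrightarrow> (\<exists>i j. i \<le> j \<and> u = w [i \<rightarrow> j])"

definition pal_complexity :: "letter word \<Rightarrow> nat \<Rightarrow> nat" where
  "pal_complexity w n = card {u. factor u w \<and> palindrome u \<and> length u = n}"

lemma fib_word_step:
  assumes "a \<ge> 1" "b \<ge> 1"
  shows "\<exists>v. fib_word a b (Suc (Suc n)) = fib_word a b (Suc n) @ v @ fib_word a b n"
proof -
  have "(if even (Suc (Suc n)) then a else b) \<noteq> 0" using assms by auto
  then obtain k where k: "(if even (Suc (Suc n)) then a else b) = Suc k"
    using not0_implies_Suc by blast
  show ?thesis by (simp only: fib_word.simps k replicate_Suc concat.simps append_assoc) blast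
qed

lemma length_fib_word_ge:
  assumes "a \<ge> 1" "b \<ge> 1"
  shows "length (fib_word a b n) \<ge> n \<and> length (fib_word a b n) \<ge> 1"
proof (induction n rule: fib_word.induct[of "\<lambda>_ _. _" a b])
  case (3 a' b' n)
  obtain v where "fib_word a b (Suc (Suc n)) = fib_word a b (Suc n) @ v @ fib_word a b n"
    using fib_word_step[OF assms] by blast
  with 3 show ?case by auto
qed auto

lemma fib_word_prefix:
  assumes "a \<ge> 1" "b \<ge> 1" "1 \<le> m" "m \<le> n"
  shows "\<exists>v. fib_word a b n = fib_word a b m @ v"
  using assms(4)
proof (induction n rule: dec_induct)
  case (step n)
  then obtain k where k: "n = Suc k" using assms(3) by (cases n) auto
  obtain v where "fib_word a b (Suc n) = fib_word a b n @ v"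
    using fib_word_step[OF assms(1,2), of k] k by auto
  with step show ?case by auto
qed simp

lemma ex1_inf_fib_word:
  assumes "a \<ge> 1" "b \<ge> 1"
  shows "\<exists>!w. \<forall>n\<ge>1. prefix (length (fib_word a b n)) w = fib_word a b n"
proof
  let ?w = "\<lambda>k. fib_word a b (Suc k) ! k"
  note len = length_fib_word_ge[OF assms]
  show "\<forall>n\<ge>1. prefix (length (fib_word a b n)) ?w = fib_word a b n"
  proof (intro allI impI nth_equalityI)
    fix n k assume n: "1 \<le> n" and "k < length (prefix (length (fib_word a b n)) ?w)"
    then have k: "k < length (fib_word a b n)" by simp
    have k': "k < length (fib_word a b (Suc k))" using len[of "Suc k"] by linarith
    have "fib_word a b (Suc k) ! k = fib_word a b n ! k"
    proof (cases "n \<le> Suc k")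
      case True
      then show ?thesis using fib_word_prefix[OF assms n] k by (metis nth_append)
    next
      case False
      then show ?thesis using fib_word_prefix[OF assms, of "Suc k" n] k' by (auto simp: nth_append)
    qed
    with k show "prefix (length (fib_word a b n)) ?w ! k = fib_word a b n ! k" by simp
  qed simp
next
  fix w assume w: "\<forall>n\<ge>1. prefix (length (fib_word a b n)) w = fib_word a b n"
  show "w = (\<lambda>k. fib_word a b (Suc k) ! k)"
  proof
    fix k
    have "k < length (fib_word a b (Suc k))"
      using length_fib_word_ge[OF assms, of "Suc k"] by linarith
    moreover have "prefix (length (fib_word a b (Suc k))) w = fib_word a b (Suc k)"
      using w by simp
    ultimately show "w k = fib_word a b (Suc k) ! k"
      by (metis add_0 diff_zero subsequence_nth)
  qed
qed

end

theory Submission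
  imports Defs
begin

text \<open>
  Write \<open>f n\<close> for \<open>fib_word a b n\<close>.  The reason for the theorem is that, for \<open>n \<ge> 2\<close>, deleting
  the last two letters of \<open>f n\<close> leaves a palindrome; these palindromes are prefixes of the
  infinite word, and their lengths are unbounded.

  Palindromicity alone does not survive the recursion \<open>f (n + 2) = f (n + 1)\<^sup>k f n\<close>.  It does
  together with near-commutation: consecutive words have the form \<open>P x y\<close> and \<open>Q y x\<close>, with
  opposite last two letters, and their two products agree except in these letters, that is,
  \<open>P x y Q = Q y x P\<close>.  This identity lets \<open>Q\<close> move through a power,
  \<open>(P x y)\<^sup>k Q = Q (y x P)\<^sup>k\<close>.  For palindromes \<open>P\<close> and \<open>Q\<close> the right-hand side is the reversal
  of the left-hand side, which is therefore a palindrome: it is \<open>f (n + 2)\<close> without its last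
  two letters.  The lemma \<open>near_commuting_step\<close> is this induction step.  The induction starts at
  the words of index 2 and 3, because shorter ones do not have two letters to delete.
\<close>

lemma concat_replicate_swap:
  assumes "u @ q = q @ v"
  shows "concat (replicate k u) @ q = q @ concat (replicate k v)"
proof (induction k)
  case (Suc k)
  have "concat (replicate (Suc k) u) @ q = u @ q @ concat (replicate k v)"
    using Suc.IH by simp
  also have "\<dots> = (q @ v) @ concat (replicate k v)"
    using assms by (metis append_assoc)
  finally show ?case by simp
qed simp

lemma rev_concat_replicate:
  "rev (concat (replicate k u)) = concat (replicate k (rev u))"
  by (simp add: rev_concat)

definition near_commuting :: "'a list \<Rightarrow> 'a list \<Rightarrow> bool" where
  "near_commuting u v \<longleftrightarrow> (\<exists>P Q x y. u = P @ [x, y] \<and> v = Q @ [y, x]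
     \<and> palindrome P \<and> palindrome Q \<and> P @ [x, y] @ Q = Q @ [y, x] @ P)"

text \<open>The new palindrome is \<open>R = (P x y)\<^sup>k Q\<close>.  Reversing it gives \<open>Q (y x P)\<^sup>k\<close>, and moving
  \<open>Q\<close> back to the end restores \<open>R\<close>.  Near-commutation with \<open>P x y\<close> is inherited because
  \<open>R y x P = (P x y)\<^sup>k Q y x P = (P x y)\<^sup>k P x y Q = P x y R\<close>.\<close>

lemma near_commuting_step:
  assumes "near_commuting u v"
  shows "near_commuting (concat (replicate k u) @ v) u"
proof -
  obtain P Q x y where u: "u = P @ [x, y]" and v: "v = Q @ [y, x]"
    and P: "rev P = P" and Q: "rev Q = Q" and comm: "P @ [x, y] @ Q = Q @ [y, x] @ P"
    using assms unfolding near_commuting_def palindrome_def by blast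
  define R where "R = concat (replicate k u) @ Q"
  have uQ: "u @ Q = Q @ [y, x] @ P"
    using comm u by simp
  have "rev R = Q @ concat (replicate k ([y, x] @ P))"
    by (simp add: R_def rev_concat_replicate u P Q)
  also have "\<dots> = R"
    using concat_replicate_swap[OF uQ, of k] by (simp add: R_def)
  finally have "rev R = R" .
  moreover have "R @ [y, x] @ P = P @ [x, y] @ R"
  proof -
    have "R @ [y, x] @ P = concat (replicate k u) @ u @ Q"
      using uQ by (simp add: R_def)
    also have "\<dots> = u @ concat (replicate k u) @ Q"
      using concat_replicate_swap[of u u u k] by (metis append_assoc)
    finally show ?thesis by (simp add: R_def u)
  qed
  moreover have "concat (replicate k u) @ v = R @ [y, x]"
    by (simp add: R_def v)
  ultimately show ?thesis
    unfolding near_commuting_def palindrome_def using u P by blast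
qed

text \<open>With \<open>Z = 0\<^sup>a\<close> the two words are \<open>Z 1\<close> and \<open>(Z 1)\<^sup>b 0\<close>.  Deleting two letters
  leaves \<open>0\<^bsup>a-1\<^esup>\<close> and \<open>(Z 1)\<^bsup>b-1\<^esup> Z\<close>, and both products in the near-commutation identity
  are \<open>(Z 1)\<^sup>b Z\<close>.\<close>

lemma near_commuting_base:
  assumes "a \<ge> 1" and "b \<ge> 1"
  shows "near_commuting (fib_word a b 3) (fib_word a b 2)"
proof -
  obtain c d where ab: "a = Suc c" "b = Suc d"
    using assms by (cases a; cases b) auto
  define Q where "Q = replicate c Zero"
  define Z where "Z = replicate a Zero"
  define P where "P = concat (replicate d (Z @ [One])) @ Z"
  have zeros: "concat (replicate n [Zero]) = replicate n Zero" for n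
    by (induction n) auto
  have Z: "Z = Zero # Q" "Z = Q @ [Zero]"
    by (simp_all add: Z_def Q_def ab replicate_append_same)
  have f2: "fib_word a b 2 = Z @ [One]"
    by (simp add: numeral_2_eq_2 zeros Z_def)
  have pow: "concat (replicate b (Z @ [One])) = concat (replicate d (Z @ [One])) @ Z @ [One]"
    using concat_replicate_swap[of "Z @ [One]" "Z @ [One]" "Z @ [One]" d] by (simp add: ab)
  have "fib_word a b (Suc (Suc (Suc 0))) =
      concat (replicate b (fib_word a b (Suc (Suc 0)))) @ [Zero]"
    by simp
  then have "fib_word a b 3 = concat (replicate b (fib_word a b 2)) @ [Zero]"
    by (simp only: numeral_2_eq_2 numeral_3_eq_3)
  then have f3: "fib_word a b 3 = P @ [One, Zero]"
    by (simp add: f2 pow P_def)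
  have "rev P = P"
    using concat_replicate_swap[of "Z @ [One]" Z "[One] @ Z" d]
    by (simp add: P_def rev_concat_replicate Z_def)
  moreover have "rev Q = Q"
    by (simp add: Q_def)
  moreover have "P @ [One, Zero] @ Q = Q @ [Zero, One] @ P"
  proof -
    have "P @ [One, Zero] @ Q = concat (replicate b (Z @ [One])) @ Z"
      by (simp add: P_def pow flip: Z(1))
    also have "\<dots> = (Z @ [One]) @ P"
      by (simp add: ab P_def)
    finally show ?thesis by (simp add: Z(2))
  qed
  moreover have "fib_word a b 2 = Q @ [Zero, One]"
    by (simp add: f2 Z(2))
  ultimately show ?thesis
    using f3 unfolding near_commuting_def palindrome_def by blast
qed

lemma near_commuting_fib_word:
  assumes "a \<ge> 1" and "b \<ge> 1" and "n \<ge> 2"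
  shows "near_commuting (fib_word a b (Suc n)) (fib_word a b n)"
  using \<open>n \<ge> 2\<close>
proof (induction n rule: dec_induct)
  case base
  show ?case
    using near_commuting_base[OF assms(1,2)] by (simp add: numeral_2_eq_2 numeral_3_eq_3)
next
  case (step n)
  then show ?case
    using near_commuting_step by (simp only: fib_word.simps)
qed

lemma fib_word_prefix_inf_fib_word:
  assumes "a \<ge> 1" and "b \<ge> 1" and "n \<ge> 1"
  shows "prefix (length (fib_word a b n)) (inf_fib_word a b) = fib_word a b n"
  using theI'[OF ex1_inf_fib_word[OF assms(1,2)]] \<open>n \<ge> 1\<close>
  unfolding inf_fib_word_def by blast

lemma palindrome_prefix_inf_fib_word:
  assumes "a \<ge> 1" and "b \<ge> 1" and "n \<ge> 2"
  shows "palindrome (prefix (length (fib_word a b n) - 2) (inf_fib_word a b))"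
proof -
  let ?f = "fib_word a b n" and ?w = "inf_fib_word a b"
  obtain Q x y where f: "?f = Q @ [y, x]" and Q: "palindrome Q"
    using near_commuting_fib_word[OF assms] unfolding near_commuting_def by blast
  have "prefix (length ?f - 2) ?w = take (length ?f - 2) (prefix (length ?f) ?w)"
    by simp
  also have "\<dots> = take (length ?f - 2) ?f"
    using fib_word_prefix_inf_fib_word[of a b n] assms by simp
  also have "\<dots> = Q"
    by (simp add: f)
  finally show ?thesis
    using Q by simp
qed

text \<open>Finiteness of the alphabet matters here: the cardinality of an infinite set is 0 by
  convention, so that one palindromic factor alone would not give a positive count.\<close>

lemma pal_complexity_pos:
  assumes "palindrome (prefix m w)"
  shows "pal_complexity w m \<ge> 1"
proof -
  let ?S = "{u. factor u w \<and> palindrome u \<and> length u = m}"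
  have "finite (UNIV :: letter set)"
    by (rule finite_subset[of _ "{Zero, One}"]) (auto intro: letter.exhaust)
  then have "finite {u :: letter list. set u \<subseteq> UNIV \<and> length u = m}"
    by (rule finite_lists_length_eq)
  then have "finite ?S"
    by (rule rev_finite_subset) auto
  moreover have "prefix m w \<in> ?S"
    using assms by (auto simp: factor_def)
  ultimately have "card ?S > 0"
    by (auto simp: card_gt_0_iff)
  then show ?thesis
    by (simp add: pal_complexity_def)
qed

theorem corollary4p12:
  fixes a b :: nat
  assumes "a \<ge> 1" and "b \<ge> 1"
  shows "(\<forall>N. \<exists>m\<ge>N. palindrome (prefix m (inf_fib_word a b)))
    \<and> (\<forall>n\<ge>2. pal_complexity (inf_fib_word a b) (length (fib_word a b n) - 2) \<ge> 1)"
proof (intro conjI allI impI)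
  fix N
  have "length (fib_word a b (N + 2)) - 2 \<ge> N"
    using length_fib_word_ge[OF assms, of "N + 2"] by linarith
  then show "\<exists>m\<ge>N. palindrome (prefix m (inf_fib_word a b))"
    using palindrome_prefix_inf_fib_word[OF assms, of "N + 2"] by auto
next
  fix n :: nat
  assume "n \<ge> 2"
  then show "pal_complexity (inf_fib_word a b) (length (fib_word a b n) - 2) \<ge> 1"
    using pal_complexity_pos palindrome_prefix_inf_fib_word[OF assms] by blast
qed

end
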